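(* Let $\mathcal{CS}$ be any constant specification. For every formula $A$ of the language of $\mathsf{LP}^{\mathsf{C}}_h$: $\vdash_{\mathcal{CS}} A$ if and only if $\mathcal{M}\Vdash A$ for every M-model $\mathcal{M}$ meeting $\mathcal{CS}$, where an M-model is an AF-model whose set of worlds is a singleton.
   Context: Fix a number $h\ge 1$ of agents. Throughout, $i$ ranges over $\{1,\dots,h\}$, $*$ over $\{1,\dots,h,\mathsf{C}\}$, and $\circledast$ over $\{1,\dots,h,\mathsf{E},\mathsf{C}\}$. For each $\circledast$ let $\mathrm{Cons}_\circledast$ (proof constants) and $\mathrm{Var}_\circledast$ (proof variables) be countably infinite sets, all pairwise disjoint. Evidence terms $\mathrm{Tm}_1,\dots,\mathrm{Tm}_h,\mathrm{Tm}_{\mathsf{E}},\mathrm{Tm}_{\mathsf{C}}$ are defined by simultaneous induction: $\mathrm{Cons}_\circledast\cup\mathrm{Var}_\circledast\subseteq\mathrm{Tm}_\circledast$; if $t\in\mathrm{Tm}_i$ then $!_i t\in\mathrm{Tm}_i$; if $t,s\in\mathrm{Tm}_*$ then $t+_*s,\ t\cdot_* s\in\mathrm{Tm}_*$; if $t_1\in\mathrm{Tm}_1,\dots,t_h\in\mathrm{Tm}_h$ then $\langle t_1,\dots,t_h\rangle\in\mathrm{Tm}_{\mathsf{E}}$; if $t\in\mathrm{Tm}_{\mathsf{E}}$ then $\pi_i t\in\mathrm{Tm}_i$; if $t\in\mathrm{Tm}_{\mathsf{C}}$ then $\mathsf{hd}(t),\mathsf{tl}(t)\in\mathrm{Tm}_{\mathsf{E}}$;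 if $t\in\mathrm{Tm}_{\mathsf{C}}$ and $s\in\mathrm{Tm}_{\mathsf{E}}$ then $\mathsf{ind}(t,s)\in\mathrm{Tm}_{\mathsf{C}}$. $\mathrm{Tm}$ is the union of all these sets. Formulae are built from a countable set $\mathrm{Prop}$ of propositional variables using $\neg,\wedge,\vee,\to$ and the rule: if $A$ is a formula and $t\in\mathrm{Tm}_\circledast$ then $t{:}_\circledast A$ is a formula (indices on $!,+,\cdot$ omitted when clear). Axioms of $\mathsf{LP}^{\mathsf{C}}_h$ (all instances): (1) propositional tautologies; (2) $t{:}_*(A\to B)\to(s{:}_*A\to (t\cdot s){:}_*B)$; (3) $t{:}_*A\to(t+s){:}_*A$ and $s{:}_*A\to(t+s){:}_*A$; (4) $t{:}_iA\to A$; (5) $t{:}_iA\to (!t){:}_i\, t{:}_iA$; (6) $t_1{:}_1A\wedge\dots\wedge t_h{:}_hA\to\langle t_1,\dots,t_h\rangle{:}_{\mathsf{E}}A$; (7) $t{:}_{\mathsf{E}}A\to (\pi_it){:}_iA$; (8) $t{:}_{\mathsf{C}}A\to\mathsf{hd}(t){:}_{\mathsf{E}}A$ and $t{:}_{\mathsf{C}}A\to\mathsf{tl}(t){:}_{\mathsf{E}}\,t{:}_{\mathsf{C}}A$; (9) $A\wedge t{:}_{\mathsf{C}}(A\to s{:}_{\mathsf{E}}A)\to\mathsf{ind}(t,s){:}_{\mathsf{C}}A$. A constant specification $\mathcal{CS}$ is any set of formulae $c{:}_\circledast A$ with $c\in\mathrm{Cons}_\circledast$ and $A$ an axiom. $\mathsf{LP}^{\mathsf{C}}_h(\mathcal{CS})$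 is the Hilbert system with these axioms, modus ponens, and axiom necessitation (derive $c{:}_\circledast A$ whenever $c{:}_\circledast A\in\mathcal{CS}$); $\vdash_{\mathcal{CS}}A$ means $A$ is derivable in it. AF-models: an AF-model meeting $\mathcal{CS}$ is $\mathcal{M}=(W,R,\mathcal{E},\nu)$ with $W\neq\emptyset$, reflexive transitive relations $R_1,\dots,R_h$ on $W$, $\nu:\mathrm{Prop}\to\mathcal{P}(W)$, $R_{\mathsf{E}}:=R_1\cup\dots\cup R_h$, $R_{\mathsf{C}}:=\bigcup_{n\ge1}(R_{\mathsf{E}})^n$, and an evidence function $\mathcal{E}:W\times\mathrm{Tm}\to\mathcal{P}(\text{formulae})$, writing $\mathcal{E}_\circledast$ for its restriction to $W\times\mathrm{Tm}_\circledast$, such that for all $w,v\in W$: (monotonicity) $\mathcal{E}_*(w,t)\subseteq\mathcal{E}_*(v,t)$ whenever $(w,v)\in R_*$; (constant specification) $c{:}_\circledast A\in\mathcal{CS}$ implies $A\in\mathcal{E}_\circledast(w,c)$; (application) $A\to B\in\mathcal{E}_*(w,t)$ and $A\in\mathcal{E}_*(w,s)$ imply $B\in\mathcal{E}_*(w,t\cdot s)$; (sum) $\mathcal{E}_*(w,s)\cup\mathcal{E}_*(w,t)\subseteq\mathcal{E}_*(w,s+t)$; (inspection) $A\in\mathcal{E}_i(w,t)$ implies $t{:}_iA\in\mathcal{E}_i(w,!t)$; (tupling) $A\in\mathcal{E}_i(w,t_i)$ for all $i$ implies $A\in\mathcal{E}_{\mathsf{E}}(w,\langle t_1,\dots,t_h\rangle)$;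 (projection) $A\in\mathcal{E}_{\mathsf{E}}(w,t)$ implies $A\in\mathcal{E}_i(w,\pi_it)$; (co-closure) $A\in\mathcal{E}_{\mathsf{C}}(w,t)$ implies $A\in\mathcal{E}_{\mathsf{E}}(w,\mathsf{hd}(t))$ and $t{:}_{\mathsf{C}}A\in\mathcal{E}_{\mathsf{E}}(w,\mathsf{tl}(t))$; (induction) $A\in\mathcal{E}_{\mathsf{E}}(w,s)$ and $A\to s{:}_{\mathsf{E}}A\in\mathcal{E}_{\mathsf{C}}(w,t)$ imply $A\in\mathcal{E}_{\mathsf{C}}(w,\mathsf{ind}(t,s))$. Satisfaction: $\mathcal{M},w\Vdash P$ iff $w\in\nu(P)$; classical for connectives; $\mathcal{M},w\Vdash t{:}_\circledast A$ iff $A\in\mathcal{E}_\circledast(w,t)$ and $\mathcal{M},v\Vdash A$ for all $v$ with $(w,v)\in R_\circledast$. $\mathcal{M}\Vdash A$ means $\mathcal{M},w\Vdash A$ for all $w\in W$. *)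

theory Defs
  imports "HOL-Library.Countable"
begin

text \<open>The agents are the numbers \<open>1, \<dots>, h\<close>.\<close>

datatype sort = Agent nat | Everyone | Common

definition all_sorts :: "nat \<Rightarrow> sort set" where
  "all_sorts h = Agent ` {1..h} \<union> {Everyone, Common}"

definition star_sorts :: "nat \<Rightarrow> sort set" where
  "star_sorts h = Agent ` {1..h} \<union> {Common}"

text \<open>
  Raw terms carry the index of their outermost operation, so that the sets of terms of
  different sorts are disjoint; the actual evidence terms are singled out by \<open>is_tm\<close>.
\<close>

datatype tm =
    Const sort nat
  | Var sort nat
  | Bang nat tm
  | Plus sort tm tm
  | App sort tm tm
  | Tuple "tm list"
  | Proj nat tm
  | Hd tm
  | Tl tm
  | Ind tm tm

inductive is_tm :: "nat \<Rightarrow> sort \<Rightarrow> tm \<Rightarrow> bool" for h where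
  Const: "s \<in> all_sorts h \<Longrightarrow> is_tm h s (Const s n)"
| Var: "s \<in> all_sorts h \<Longrightarrow> is_tm h s (Var s n)"
| Bang: "i \<in> {1..h} \<Longrightarrow> is_tm h (Agent i) t \<Longrightarrow> is_tm h (Agent i) (Bang i t)"
| Plus: "s \<in> star_sorts h \<Longrightarrow> is_tm h s t \<Longrightarrow> is_tm h s u \<Longrightarrow> is_tm h s (Plus s t u)"
| App: "s \<in> star_sorts h \<Longrightarrow> is_tm h s t \<Longrightarrow> is_tm h s u \<Longrightarrow> is_tm h s (App s t u)"
| Tuple: "length ts = h \<Longrightarrow> (\<And>i. i \<in> {1..h} \<Longrightarrow> is_tm h (Agent i) (ts ! (i - 1))) \<Longrightarrow>
    is_tm h Everyone (Tuple ts)"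
| Proj: "i \<in> {1..h} \<Longrightarrow> is_tm h Everyone t \<Longrightarrow> is_tm h (Agent i) (Proj i t)"
| Hd: "is_tm h Common t \<Longrightarrow> is_tm h Everyone (Hd t)"
| Tl: "is_tm h Common t \<Longrightarrow> is_tm h Everyone (Tl t)"
| Ind: "is_tm h Common t \<Longrightarrow> is_tm h Everyone u \<Longrightarrow> is_tm h Common (Ind t u)"

datatype 'p fm =
    Atom 'p
  | Neg "'p fm"  ("\<^bold>\<not> _" [70] 70)
  | And "'p fm" "'p fm"  (infixr "\<^bold>\<and>" 65)
  | Or "'p fm" "'p fm"  (infixr "\<^bold>\<or>" 60)
  | Imp "'p fm" "'p fm"  (infixr "\<^bold>\<longrightarrow>" 55)
  | Ev tm sort "'p fm"  ("_ :\<^bsub>_\<^esub> _" [76, 0, 75] 75)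

inductive_set Fm :: "nat \<Rightarrow> 'p fm set" for h where
  Atom: "Atom p \<in> Fm h"
| Neg: "A \<in> Fm h \<Longrightarrow> \<^bold>\<not> A \<in> Fm h"
| And: "A \<in> Fm h \<Longrightarrow> B \<in> Fm h \<Longrightarrow> A \<^bold>\<and> B \<in> Fm h"
| Or: "A \<in> Fm h \<Longrightarrow> B \<in> Fm h \<Longrightarrow> A \<^bold>\<or> B \<in> Fm h"
| Imp: "A \<in> Fm h \<Longrightarrow> B \<in> Fm h \<Longrightarrow> A \<^bold>\<longrightarrow> B \<in> Fm h"
| Ev: "s \<in> all_sorts h \<Longrightarrow> is_tm h s t \<Longrightarrow> A \<in> Fm h \<Longrightarrow> t :\<^bsub>s\<^esub> A \<in> Fm h"

text \<open>
  For propositional tautologies, a truth assignment \<open>v\<close> values the formulae that are not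
  built by a connective, i.e. the variables and the formulae \<open>t :\<^bsub>s\<^esub> A\<close>.
\<close>

primrec prop_eval :: "('p fm \<Rightarrow> bool) \<Rightarrow> 'p fm \<Rightarrow> bool" where
  "prop_eval v (Atom p) = v (Atom p)"
| "prop_eval v (\<^bold>\<not> A) = (\<not> prop_eval v A)"
| "prop_eval v (A \<^bold>\<and> B) = (prop_eval v A \<and> prop_eval v B)"
| "prop_eval v (A \<^bold>\<or> B) = (prop_eval v A \<or> prop_eval v B)"
| "prop_eval v (A \<^bold>\<longrightarrow> B) = (prop_eval v A \<longrightarrow> prop_eval v B)"
| "prop_eval v (t :\<^bsub>s\<^esub> A) = v (t :\<^bsub>s\<^esub> A)"

definition tautology :: "'p fm \<Rightarrow> bool" where
  "tautology A \<longleftrightarrow> (\<forall>v. prop_eval v A)"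

text \<open>Iterated conjunction of a nonempty list, associated to the right.\<close>

fun conj_list :: "'p fm list \<Rightarrow> 'p fm" where
  "conj_list [A] = A"
| "conj_list (A # B # As) = A \<^bold>\<and> conj_list (B # As)"

inductive_set axioms :: "nat \<Rightarrow> 'p fm set" for h where
  taut: "A \<in> Fm h \<Longrightarrow> tautology A \<Longrightarrow> A \<in> axioms h"
| app: "s \<in> star_sorts h \<Longrightarrow> is_tm h s t \<Longrightarrow> is_tm h s u \<Longrightarrow> A \<in> Fm h \<Longrightarrow> B \<in> Fm h \<Longrightarrow>
    t :\<^bsub>s\<^esub> (A \<^bold>\<longrightarrow> B) \<^bold>\<longrightarrow> (u :\<^bsub>s\<^esub> A \<^bold>\<longrightarrow> App s t u :\<^bsub>s\<^esub> B) \<in> axioms h"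
| sum_left: "s \<in> star_sorts h \<Longrightarrow> is_tm h s t \<Longrightarrow> is_tm h s u \<Longrightarrow> A \<in> Fm h \<Longrightarrow>
    t :\<^bsub>s\<^esub> A \<^bold>\<longrightarrow> Plus s t u :\<^bsub>s\<^esub> A \<in> axioms h"
| sum_right: "s \<in> star_sorts h \<Longrightarrow> is_tm h s t \<Longrightarrow> is_tm h s u \<Longrightarrow> A \<in> Fm h \<Longrightarrow>
    u :\<^bsub>s\<^esub> A \<^bold>\<longrightarrow> Plus s t u :\<^bsub>s\<^esub> A \<in> axioms h"
| reflection: "i \<in> {1..h} \<Longrightarrow> is_tm h (Agent i) t \<Longrightarrow> A \<in> Fm h \<Longrightarrow>
    t :\<^bsub>Agent i\<^esub> A \<^bold>\<longrightarrow> A \<in> axioms h"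
| inspection: "i \<in> {1..h} \<Longrightarrow> is_tm h (Agent i) t \<Longrightarrow> A \<in> Fm h \<Longrightarrow>
    t :\<^bsub>Agent i\<^esub> A \<^bold>\<longrightarrow> Bang i t :\<^bsub>Agent i\<^esub> (t :\<^bsub>Agent i\<^esub> A) \<in> axioms h"
| tupling: "length ts = h \<Longrightarrow> (\<And>i. i \<in> {1..h} \<Longrightarrow> is_tm h (Agent i) (ts ! (i - 1))) \<Longrightarrow> A \<in> Fm h \<Longrightarrow>
    conj_list (map (\<lambda>i. (ts ! (i - 1)) :\<^bsub>Agent i\<^esub> A) [1..<Suc h]) \<^bold>\<longrightarrow> Tuple ts :\<^bsub>Everyone\<^esub> A
      \<in> axioms h"
| projection: "i \<in> {1..h} \<Longrightarrow> is_tm h Everyone t \<Longrightarrow> A \<in> Fm h \<Longrightarrow>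
    t :\<^bsub>Everyone\<^esub> A \<^bold>\<longrightarrow> Proj i t :\<^bsub>Agent i\<^esub> A \<in> axioms h"
| co_closure_head: "is_tm h Common t \<Longrightarrow> A \<in> Fm h \<Longrightarrow>
    t :\<^bsub>Common\<^esub> A \<^bold>\<longrightarrow> Hd t :\<^bsub>Everyone\<^esub> A \<in> axioms h"
| co_closure_tail: "is_tm h Common t \<Longrightarrow> A \<in> Fm h \<Longrightarrow>
    t :\<^bsub>Common\<^esub> A \<^bold>\<longrightarrow> Tl t :\<^bsub>Everyone\<^esub> (t :\<^bsub>Common\<^esub> A) \<in> axioms h"
| induction: "is_tm h Common t \<Longrightarrow> is_tm h Everyone u \<Longrightarrow> A \<in> Fm h \<Longrightarrow>
    A \<^bold>\<and> t :\<^bsub>Common\<^esub> (A \<^bold>\<longrightarrow> u :\<^bsub>Everyone\<^esub> A) \<^bold>\<longrightarrow> Ind t u :\<^bsub>Common\<^esub> A \<in> axioms h"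

definition const_spec :: "nat \<Rightarrow> 'p fm set \<Rightarrow> bool" where
  "const_spec h CS \<longleftrightarrow> CS \<subseteq> {Const s n :\<^bsub>s\<^esub> A | s n A. s \<in> all_sorts h \<and> A \<in> axioms h}"

inductive derivable :: "nat \<Rightarrow> 'p fm set \<Rightarrow> 'p fm \<Rightarrow> bool" for h CS where
  ax: "A \<in> axioms h \<Longrightarrow> derivable h CS A"
| mp: "derivable h CS (A \<^bold>\<longrightarrow> B) \<Longrightarrow> derivable h CS A \<Longrightarrow> derivable h CS B"
| nec: "Const s n :\<^bsub>s\<^esub> A \<in> CS \<Longrightarrow> derivable h CS (Const s n :\<^bsub>s\<^esub> A)"

record ('w, 'p) model =
  worlds :: "'w set"
  rel :: "nat \<Rightarrow> ('w \<times> 'w) set"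
  evid :: "'w \<Rightarrow> tm \<Rightarrow> 'p fm set"
  val :: "'p \<Rightarrow> 'w set"

definition rel_E :: "nat \<Rightarrow> ('w, 'p) model \<Rightarrow> ('w \<times> 'w) set" where
  "rel_E h M = (\<Union>i\<in>{1..h}. rel M i)"

definition rel_C :: "nat \<Rightarrow> ('w, 'p) model \<Rightarrow> ('w \<times> 'w) set" where
  "rel_C h M = (\<Union>n\<in>{1..}. rel_E h M ^^ n)"

primrec access :: "nat \<Rightarrow> ('w, 'p) model \<Rightarrow> sort \<Rightarrow> ('w \<times> 'w) set" where
  "access h M (Agent i) = rel M i"
| "access h M Everyone = rel_E h M"
| "access h M Common = rel_C h M"

locale af_model =
  fixes h :: nat and CS :: "'p fm set" and M :: "('w, 'p) model"
  assumes worlds_nonempty: "worlds M \<noteq> {}"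
    and rel_on_worlds: "i \<in> {1..h} \<Longrightarrow> rel M i \<subseteq> worlds M \<times> worlds M"
    and rel_refl: "i \<in> {1..h} \<Longrightarrow> refl_on (worlds M) (rel M i)"
    and rel_trans: "i \<in> {1..h} \<Longrightarrow> trans (rel M i)"
    and val_on_worlds: "val M p \<subseteq> worlds M"
    and evid_fm: "w \<in> worlds M \<Longrightarrow> s \<in> all_sorts h \<Longrightarrow> is_tm h s t \<Longrightarrow> evid M w t \<subseteq> Fm h"
    and evid_mono: "w \<in> worlds M \<Longrightarrow> v \<in> worlds M \<Longrightarrow> s \<in> star_sorts h \<Longrightarrow> is_tm h s t \<Longrightarrow>
      (w, v) \<in> access h M s \<Longrightarrow> evid M w t \<subseteq> evid M v t"
    and evid_const: "w \<in> worlds M \<Longrightarrow> Const s n :\<^bsub>s\<^esub> A \<in> CS \<Longrightarrow> A \<in> evid M w (Const s n)"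
    and evid_app: "w \<in> worlds M \<Longrightarrow> s \<in> star_sorts h \<Longrightarrow> is_tm h s t \<Longrightarrow> is_tm h s u \<Longrightarrow>
      A \<^bold>\<longrightarrow> B \<in> evid M w t \<Longrightarrow> A \<in> evid M w u \<Longrightarrow> B \<in> evid M w (App s t u)"
    and evid_sum: "w \<in> worlds M \<Longrightarrow> s \<in> star_sorts h \<Longrightarrow> is_tm h s t \<Longrightarrow> is_tm h s u \<Longrightarrow>
      evid M w t \<union> evid M w u \<subseteq> evid M w (Plus s t u)"
    and evid_inspection: "w \<in> worlds M \<Longrightarrow> i \<in> {1..h} \<Longrightarrow> is_tm h (Agent i) t \<Longrightarrow>
      A \<in> evid M w t \<Longrightarrow> t :\<^bsub>Agent i\<^esub> A \<in> evid M w (Bang i t)"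
    and evid_tupling: "w \<in> worlds M \<Longrightarrow> length ts = h \<Longrightarrow>
      (\<And>i. i \<in> {1..h} \<Longrightarrow> is_tm h (Agent i) (ts ! (i - 1))) \<Longrightarrow>
      (\<And>i. i \<in> {1..h} \<Longrightarrow> A \<in> evid M w (ts ! (i - 1))) \<Longrightarrow> A \<in> evid M w (Tuple ts)"
    and evid_projection: "w \<in> worlds M \<Longrightarrow> i \<in> {1..h} \<Longrightarrow> is_tm h Everyone t \<Longrightarrow>
      A \<in> evid M w t \<Longrightarrow> A \<in> evid M w (Proj i t)"
    and evid_co_closure: "w \<in> worlds M \<Longrightarrow> is_tm h Common t \<Longrightarrow> A \<in> evid M w t \<Longrightarrow>
      A \<in> evid M w (Hd t) \<and> t :\<^bsub>Common\<^esub> A \<in> evid M w (Tl t)"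
    and evid_induction: "w \<in> worlds M \<Longrightarrow> is_tm h Common t \<Longrightarrow> is_tm h Everyone u \<Longrightarrow>
      A \<in> evid M w u \<Longrightarrow> A \<^bold>\<longrightarrow> u :\<^bsub>Everyone\<^esub> A \<in> evid M w t \<Longrightarrow> A \<in> evid M w (Ind t u)"

definition m_model :: "nat \<Rightarrow> 'p fm set \<Rightarrow> ('w, 'p) model \<Rightarrow> bool" where
  "m_model h CS M \<longleftrightarrow> af_model h CS M \<and> is_singleton (worlds M)"

primrec sat :: "nat \<Rightarrow> ('w, 'p) model \<Rightarrow> 'w \<Rightarrow> 'p fm \<Rightarrow> bool" where
  "sat h M w (Atom p) = (w \<in> val M p)"
| "sat h M w (\<^bold>\<not> A) = (\<not> sat h M w A)"
| "sat h M w (A \<^bold>\<and> B) = (sat h M w A \<and> sat h M w B)"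
| "sat h M w (A \<^bold>\<or> B) = (sat h M w A \<or> sat h M w B)"
| "sat h M w (A \<^bold>\<longrightarrow> B) = (sat h M w A \<longrightarrow> sat h M w B)"
| "sat h M w (t :\<^bsub>s\<^esub> A) = (A \<in> evid M w t \<and> (\<forall>v. (w, v) \<in> access h M s \<longrightarrow> sat h M v A))"

definition valid :: "nat \<Rightarrow> ('w, 'p) model \<Rightarrow> 'p fm \<Rightarrow> bool" where
  "valid h M A \<longleftrightarrow> (\<forall>w\<in>worlds M. sat h M w A)"

end

theory Submission imports Defs begin

text \<open>
  Completeness goes through a canonical model with a single world. Let \<open>S\<close> be maximal among the
  deductively closed sets of formulae omitting a given underivable formula. Then \<open>S\<close> decides every
  formula, and taking \<open>t :\<^bsub>s\<^esub> A \<in> S\<close> as the evidence relation yields an M-model. The truth lemma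
  needs no further worlds because the factivity formula \<open>t :\<^bsub>s\<^esub> A \<^bold>\<longrightarrow> A\<close> is derivable for each sort
  \<open>s\<close>, so that evidence in \<open>S\<close> already guarantees truth at the world itself.
\<close>

section \<open>Well-formedness of terms, formulae and axioms\<close>

inductive_cases Fm_NegE: "\<^bold>\<not> A \<in> Fm h"
  and Fm_AndE: "A \<^bold>\<and> B \<in> Fm h"
  and Fm_OrE: "A \<^bold>\<or> B \<in> Fm h"
  and Fm_ImpE: "A \<^bold>\<longrightarrow> B \<in> Fm h"
  and Fm_EvE: "t :\<^bsub>s\<^esub> A \<in> Fm h"

lemma Fm_simps [simp]:
  "Atom p \<in> Fm h"
  "\<^bold>\<not> A \<in> Fm h \<longleftrightarrow> A \<in> Fm h"
  "A \<^bold>\<and> B \<in> Fm h \<longleftrightarrow> A \<in> Fm h \<and> B \<in> Fm h"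
  "A \<^bold>\<or> B \<in> Fm h \<longleftrightarrow> A \<in> Fm h \<and> B \<in> Fm h"
  "A \<^bold>\<longrightarrow> B \<in> Fm h \<longleftrightarrow> A \<in> Fm h \<and> B \<in> Fm h"
  "t :\<^bsub>s\<^esub> A \<in> Fm h \<longleftrightarrow> s \<in> all_sorts h \<and> is_tm h s t \<and> A \<in> Fm h"
  by (auto intro: Fm.intros elim: Fm_NegE Fm_AndE Fm_OrE Fm_ImpE Fm_EvE)

lemma all_sorts_simps [simp]:
  "Agent i \<in> all_sorts h \<longleftrightarrow> i \<in> {1..h}"
  "Everyone \<in> all_sorts h"
  "Common \<in> all_sorts h"
  by (auto simp: all_sorts_def)

lemma star_sorts_subset: "s \<in> star_sorts h \<Longrightarrow> s \<in> all_sorts h"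
  by (auto simp: star_sorts_def)

primrec sort_of :: "tm \<Rightarrow> sort" where
  "sort_of (Const s n) = s"
| "sort_of (Var s n) = s"
| "sort_of (Bang i t) = Agent i"
| "sort_of (Plus s t u) = s"
| "sort_of (App s t u) = s"
| "sort_of (Tuple ts) = Everyone"
| "sort_of (Proj i t) = Agent i"
| "sort_of (Hd t) = Everyone"
| "sort_of (Tl t) = Everyone"
| "sort_of (Ind t u) = Common"

text \<open>Each constructor records or fixes its sort, so a term has at most one. This uniqueness
  later recovers the index of an evidence formula from an evidence function that takes no sort
  argument.\<close>

lemma is_tm_sort_of: "is_tm h s t \<Longrightarrow> sort_of t = s"
  by (induction rule: is_tm.induct) simp_all

text \<open>\<open>conj_list\<close> has no equation for the empty list, hence the restriction to
  nonempty lists. The tupling axiom meets it because \<open>h \<ge> 1\<close> provides at least one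
  agent.\<close>

lemma conj_list_Fm: "L \<noteq> [] \<Longrightarrow> conj_list L \<in> Fm h \<longleftrightarrow> set L \<subseteq> Fm h"
  by (induction L rule: conj_list.induct) auto

lemma sat_conj_list: "L \<noteq> [] \<Longrightarrow> sat h M w (conj_list L) \<longleftrightarrow> (\<forall>B\<in>set L. sat h M w B)"
  by (induction L rule: conj_list.induct) auto

lemma axioms_Fm:
  assumes "h \<ge> 1" and "A \<in> axioms h"
  shows "A \<in> Fm h"
  using assms(2)
proof cases
  case (tupling ts A)
  with is_tm.Tuple[OF tupling(2,3)] show ?thesis
    using \<open>h \<ge> 1\<close> by (auto simp: conj_list_Fm simp del: upt_Suc)
qed (auto intro: is_tm.intros star_sorts_subset)

lemma derivable_Fm:
  assumes "h \<ge> 1" and "const_spec h CS" and "derivable h CS A"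
  shows "A \<in> Fm h"
  using assms(3)
proof induction
  case (nec s n A)
  with assms(2) have "s \<in> all_sorts h" "A \<in> axioms h"
    by (auto simp: const_spec_def)
  with assms(1) show ?case by (auto intro: axioms_Fm is_tm.Const)
qed (use assms(1) axioms_Fm in auto)


subsection \<open>Soundness\<close>

text \<open>Reflexivity leaves only the loop on a singleton. For \<open>Everyone\<close> the union
  must range over a nonempty set of agents, which is where \<open>h \<ge> 1\<close> enters; for
  \<open>Common\<close> every positive power of a loop is that loop.\<close>

lemma access_one_world:
  assumes "af_model h CS M" and "worlds M = {w}" and "h \<ge> 1" and "s \<in> all_sorts h"
  shows "access h M s = {(w, w)}"
proof -
  have rel: "rel M i = {(w, w)}" if "i \<in> {1..h}" for i
    using af_model.rel_on_worlds[OF assms(1) that] af_model.rel_refl[OF assms(1) that] assms(2)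
    by (auto simp: refl_on_def)
  have "(\<Union>i\<in>{1..h}. rel M i) = (\<Union>i\<in>{1..h}. {(w, w)})"
    by (rule SUP_cong) (use rel in auto)
  then have E: "rel_E h M = {(w, w)}"
    using \<open>h \<ge> 1\<close> by (auto simp: rel_E_def)
  have "rel_E h M ^^ Suc n = {(w, w)}" for n
    by (induction n) (use E in auto)
  then have "rel_E h M ^^ n = {(w, w)}" if "n \<ge> 1" for n
    using that by (cases n) simp_all
  then have "rel_C h M = {(w, w)}"
    by (auto simp: rel_C_def)
  with rel E show ?thesis
    using assms(4) by (cases s) auto
qed

text \<open>Satisfaction at a world is itself a truth assignment to the formulae not built by a
  connective, so tautologies hold there.\<close>

lemma prop_eval_sat: "prop_eval (sat h M w) A = sat h M w A"
  by (induction A) auto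

lemma axioms_sound:
  assumes M: "af_model h CS M" and W: "worlds M = {w}" and h: "h \<ge> 1" and A: "A \<in> axioms h"
  shows "sat h M w A"
proof -
  have w: "w \<in> worlds M" using W by simp
  have sat_Ev: "sat h M w (t :\<^bsub>s\<^esub> B) \<longleftrightarrow> B \<in> evid M w t \<and> sat h M w B"
    if "s \<in> all_sorts h" for s t B
    using access_one_world[OF M W h that] by auto
  note [simp del] = sat.simps(6)
  note [simp] = sat_Ev star_sorts_subset
  from A show ?thesis
  proof cases
    case taut
    then show ?thesis by (simp add: tautology_def flip: prop_eval_sat)
  next
    case (app s t u A B)
    then show ?thesis using af_model.evid_app[OF M w, of s t u A B] by auto
  next
    case (sum_left s t u A)
    then show ?thesis using af_model.evid_sum[OF M w, of s t u] by auto
  next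
    case (sum_right s t u A)
    then show ?thesis using af_model.evid_sum[OF M w, of s t u] by auto
  next
    case (inspection i t A)
    then show ?thesis using af_model.evid_inspection[OF M w, of i t A] by auto
  next
    case (tupling ts A)
    have "sat h M w (Tuple ts :\<^bsub>Everyone\<^esub> A)"
      if "\<And>i. i \<in> {1..h} \<Longrightarrow> sat h M w ((ts ! (i - 1)) :\<^bsub>Agent i\<^esub> A)"
    proof -
      have "A \<in> evid M w (ts ! (i - 1))" if "i \<in> {1..h}" for i
        using \<open>\<And>i. i \<in> {1..h} \<Longrightarrow> sat h M w ((ts ! (i - 1)) :\<^bsub>Agent i\<^esub> A)\<close>[OF that] that by simp
      \<comment> \<open>Truth of \<open>A\<close> is read off agent 1, who exists because
        \<open>h \<ge> 1\<close>.\<close>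
      moreover have "sat h M w A"
        using that[of 1] h by simp
      ultimately show ?thesis
        using af_model.evid_tupling[OF M w, of ts A] tupling by simp
    qed
    then show ?thesis
      using h unfolding tupling(1) by (auto simp: sat_conj_list simp del: upt_Suc sat_Ev)
  next
    case (projection i t A)
    then show ?thesis using af_model.evid_projection[OF M w, of i t A] by auto
  next
    case (co_closure_head t A)
    then show ?thesis using af_model.evid_co_closure[OF M w, of t A] by auto
  next
    case (co_closure_tail t A)
    then show ?thesis using af_model.evid_co_closure[OF M w, of t A] by auto
  next
    case (induction t u A)
    \<comment> \<open>The closure condition asks for \<open>A\<close> as evidence of
      \<open>u\<close>. The world sees itself, so the implication from \<open>A\<close> to the
      evidence formula for \<open>u\<close> is true there, and truth of \<open>A\<close> yields that
      evidence.\<close>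
    then show ?thesis using af_model.evid_induction[OF M w, of t u A] by auto
  qed auto
qed

lemma soundness:
  assumes h: "h \<ge> 1" and CS: "const_spec h CS" and M: "m_model h CS M" and "derivable h CS A"
  shows "valid h M A"
proof -
  from M obtain w where AF: "af_model h CS M" and W: "worlds M = {w}"
    by (auto simp: m_model_def is_singleton_def)
  have "sat h M w A"
    using assms(4)
  proof induction
    case (ax A)
    then show ?case by (rule axioms_sound[OF AF W h])
  next
    case (mp A B)
    then show ?case by simp
  next
    case (nec s n A)
    with CS have s: "s \<in> all_sorts h" and "A \<in> axioms h"
      by (auto simp: const_spec_def)
    then have "sat h M w A" by (intro axioms_sound[OF AF W h])
    moreover have "A \<in> evid M w (Const s n)"
      using af_model.evid_const[OF AF _ nec] W by simp
    ultimately show ?case using access_one_world[OF AF W h s] by auto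
  qed
  with W show ?thesis by (simp add: valid_def)
qed


subsection \<open>Maximal deductively closed sets\<close>

text \<open>Necessitation enters only through the derivable formulae contained in \<open>S\<close>.
  With modus ponens as the sole closure rule, a closed set can be extended by an arbitrary
  assumption.\<close>

definition deductively_closed :: "nat \<Rightarrow> 'p fm set \<Rightarrow> 'p fm set \<Rightarrow> bool" where
  "deductively_closed h CS S \<longleftrightarrow> S \<subseteq> Fm h \<and> {A. derivable h CS A} \<subseteq> S \<and>
    (\<forall>A B. A \<^bold>\<longrightarrow> B \<in> S \<longrightarrow> A \<in> S \<longrightarrow> B \<in> S)"

lemma closed_mp: "deductively_closed h CS S \<Longrightarrow> A \<^bold>\<longrightarrow> B \<in> S \<Longrightarrow> A \<in> S \<Longrightarrow> B \<in> S"
  unfolding deductively_closed_def by blast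

lemma closed_Fm: "deductively_closed h CS S \<Longrightarrow> A \<in> S \<Longrightarrow> A \<in> Fm h"
  unfolding deductively_closed_def by blast

lemma closed_axiom: "deductively_closed h CS S \<Longrightarrow> A \<in> axioms h \<Longrightarrow> A \<in> S"
  unfolding deductively_closed_def by (blast intro: derivable.ax)

lemma closed_taut:
  "deductively_closed h CS S \<Longrightarrow> A \<in> Fm h \<Longrightarrow> tautology A \<Longrightarrow> A \<in> S"
  by (blast intro: closed_axiom axioms.taut)

text \<open>Propositional reasoning inside \<open>S\<close> becomes a check over truth assignments,
  which replaces explicit Hilbert-style derivations.\<close>

lemma closed_taut_consequence:
  assumes S: "deductively_closed h CS S" and "A \<in> S" and "B \<in> Fm h"
    and "\<And>v. prop_eval v A \<Longrightarrow> prop_eval v B"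
  shows "B \<in> S"
  using assms closed_taut[OF S, of "A \<^bold>\<longrightarrow> B"] closed_mp[OF S, of A B] closed_Fm[OF S, of A]
  by (simp add: tautology_def)

lemma closed_taut_consequence2:
  assumes S: "deductively_closed h CS S" and A: "A \<in> S" and B: "B \<in> S" and C: "C \<in> Fm h"
    and "\<And>v. prop_eval v A \<Longrightarrow> prop_eval v B \<Longrightarrow> prop_eval v C"
  shows "C \<in> S"
  using closed_taut_consequence[OF S A, of "B \<^bold>\<longrightarrow> C"] closed_mp[OF S, of B C] closed_Fm[OF S B] assms
  by simp

lemma closed_conj_list:
  assumes S: "deductively_closed h CS S" and "L \<noteq> []" and "set L \<subseteq> S"
  shows "conj_list L \<in> S"
  using assms(2,3)
proof (induction L rule: conj_list.induct)
  case (2 A B L)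
  then have "A \<in> S" "conj_list (B # L) \<in> S" by auto
  then show ?case
    using closed_Fm[OF S] by (auto intro: closed_taut_consequence2[OF S, of A "conj_list (B # L)"])
qed auto

text \<open>A deduction theorem in semantic dress: the formulae implied by \<open>B\<close> over
  \<open>S\<close> form a closed set containing \<open>S\<close> and \<open>B\<close>.\<close>

lemma closed_extend:
  assumes S: "deductively_closed h CS S" and B: "B \<in> Fm h"
  shows "deductively_closed h CS {C \<in> Fm h. B \<^bold>\<longrightarrow> C \<in> S}" (is "deductively_closed h CS ?T")
    and "insert B S \<subseteq> {C \<in> Fm h. B \<^bold>\<longrightarrow> C \<in> S}"
proof -
  have "C \<in> ?T" if "C \<in> S" for C
    using closed_taut_consequence[OF S that, of "B \<^bold>\<longrightarrow> C"] closed_Fm[OF S that] B by simp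
  moreover have "B \<in> ?T"
    using closed_taut[OF S, of "B \<^bold>\<longrightarrow> B"] B by (simp add: tautology_def)
  ultimately show "insert B S \<subseteq> ?T" by blast
  then have "{C. derivable h CS C} \<subseteq> ?T"
    using S unfolding deductively_closed_def by blast
  moreover have "D \<in> ?T" if "C \<^bold>\<longrightarrow> D \<in> ?T" "C \<in> ?T" for C D
    using that B closed_taut_consequence2[OF S, of "B \<^bold>\<longrightarrow> (C \<^bold>\<longrightarrow> D)" "B \<^bold>\<longrightarrow> C" "B \<^bold>\<longrightarrow> D"] by simp
  ultimately show "deductively_closed h CS ?T"
    unfolding deductively_closed_def by blast
qed

text \<open>Omitting the fixed formula \<open>F\<close> plays the part of consistency.\<close>

locale maximal_closed =
  fixes h :: nat and CS :: "'p fm set" and F :: "'p fm" and S :: "'p fm set"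
  assumes h: "h \<ge> 1"
    and F: "F \<in> Fm h"
    and closed: "deductively_closed h CS S"
    and F_notin: "F \<notin> S"
    and maximal: "deductively_closed h CS T \<Longrightarrow> S \<subseteq> T \<Longrightarrow> F \<notin> T \<Longrightarrow> T = S"

text \<open>Zorn's lemma, started from the set of derivable formulae.\<close>

lemma maximal_closed_exists:
  assumes "h \<ge> 1" and "const_spec h CS" and "F \<in> Fm h" and "\<not> derivable h CS F"
  shows "\<exists>S. maximal_closed h CS F S"
proof -
  let ?\<A> = "{S. deductively_closed h CS S \<and> F \<notin> S}"
  have "{A. derivable h CS A} \<in> ?\<A>"
    using assms derivable_Fm by (auto simp: deductively_closed_def intro: derivable.mp)
  then have "?\<A> \<noteq> {}" by blast
  moreover have "\<Union> \<C> \<in> ?\<A>" if "\<C> \<noteq> {}" and chain: "subset.chain ?\<A> \<C>" for \<C>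
  proof -
    have sub: "\<C> \<subseteq> ?\<A>" using chain by (simp add: subset_chain_def)
    have "B \<in> \<Union> \<C>" if AB: "A \<^bold>\<longrightarrow> B \<in> \<Union> \<C>" and A: "A \<in> \<Union> \<C>" for A B
    proof -
      obtain S T where "S \<in> \<C>" "A \<^bold>\<longrightarrow> B \<in> S" "T \<in> \<C>" "A \<in> T" using AB A by blast
      \<comment> \<open>Members of a chain are comparable, so the larger of \<open>S\<close> and
        \<open>T\<close> contains both premises.\<close>
      then obtain U where "U \<in> \<C>" "A \<^bold>\<longrightarrow> B \<in> U" "A \<in> U"
        using chain unfolding subset_chain_def by blast
      with sub show ?thesis using closed_mp by blast
    qed
    moreover have "\<Union> \<C> \<subseteq> Fm h"
      using sub closed_Fm by blast
    moreover have "{A. derivable h CS A} \<subseteq> \<Union> \<C>"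
      using sub \<open>\<C> \<noteq> {}\<close> by (auto simp: deductively_closed_def) blast
    moreover have "F \<notin> \<Union> \<C>" using sub by blast
    ultimately show ?thesis unfolding deductively_closed_def by blast
  qed
  ultimately obtain S where "S \<in> ?\<A>" and "\<forall>T\<in>?\<A>. S \<subseteq> T \<longrightarrow> T = S"
    using subset_Zorn_nonempty[of ?\<A>] by blast
  then have "maximal_closed h CS F S"
    using assms by unfold_locales auto
  then show ?thesis ..
qed

section \<open>Maximal sets respect the connectives and are factive\<close>

context maximal_closed
begin

lemmas S_mp = closed_mp[OF closed]
lemmas S_Fm = closed_Fm[OF closed]
lemmas S_axiom = closed_axiom[OF closed]
lemmas S_taut1 = closed_taut_consequence[OF closed]
lemmas S_taut2 = closed_taut_consequence2[OF closed]

text \<open>The closed extension of \<open>S\<close> by \<open>B\<close> is strictly larger than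
  \<open>S\<close>, so by maximality it contains \<open>F\<close>.\<close>

lemma notin_imp:
  assumes "B \<in> Fm h" and "B \<notin> S"
  shows "B \<^bold>\<longrightarrow> F \<in> S"
  using maximal[OF closed_extend(1)[OF closed assms(1)]] closed_extend(2)[OF closed assms(1)] assms(2)
  by blast

text \<open>Both \<open>B\<close> and its negation in \<open>S\<close> would put \<open>F\<close>
  there. If both were absent, each would imply \<open>F\<close> inside \<open>S\<close>, and a case
  distinction would again give \<open>F\<close>.\<close>

lemma Neg_iff: "B \<in> Fm h \<Longrightarrow> \<^bold>\<not> B \<in> S \<longleftrightarrow> B \<notin> S"
  using S_taut2[of "\<^bold>\<not> B" B F] S_taut2[of "\<^bold>\<not> B \<^bold>\<longrightarrow> F" "B \<^bold>\<longrightarrow> F" F]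
    notin_imp[of B] notin_imp[of "\<^bold>\<not> B"] F F_notin
  by auto

lemma And_iff:
  assumes "A \<in> Fm h" "B \<in> Fm h"
  shows "A \<^bold>\<and> B \<in> S \<longleftrightarrow> A \<in> S \<and> B \<in> S"
  using assms S_taut2[of A B "A \<^bold>\<and> B"] S_taut1[of "A \<^bold>\<and> B" A] S_taut1[of "A \<^bold>\<and> B" B] by auto

lemma Or_iff:
  assumes "A \<in> Fm h" "B \<in> Fm h"
  shows "A \<^bold>\<or> B \<in> S \<longleftrightarrow> A \<in> S \<or> B \<in> S"
  using assms S_taut2[of "A \<^bold>\<or> B" "\<^bold>\<not> A" B] S_taut1[of A "A \<^bold>\<or> B"] S_taut1[of B "A \<^bold>\<or> B"] Neg_iff[of A]
  by auto

lemma Imp_iff: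
  assumes "A \<in> Fm h" "B \<in> Fm h"
  shows "A \<^bold>\<longrightarrow> B \<in> S \<longleftrightarrow> (A \<in> S \<longrightarrow> B \<in> S)"
  using assms S_mp[of A B] S_taut1[of B "A \<^bold>\<longrightarrow> B"] S_taut1[of "\<^bold>\<not> A" "A \<^bold>\<longrightarrow> B"] Neg_iff[of A]
  by auto

text \<open>Reflection is an axiom for agents only. \<open>Everyone\<close> reduces to agent 1 by
  projection, and \<open>Common\<close> reduces to \<open>Everyone\<close> by
  \<open>Hd\<close>.\<close>

lemma Ev_factive:
  assumes "t :\<^bsub>s\<^esub> A \<in> S"
  shows "A \<in> S"
proof -
  have agent: "A \<in> S" if "t :\<^bsub>Agent i\<^esub> A \<in> S" for t i
    using S_mp[OF S_axiom[OF axioms.reflection] that] S_Fm[OF that] by simp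
  have everyone: "A \<in> S" if "t :\<^bsub>Everyone\<^esub> A \<in> S" for t
    using agent[OF S_mp[OF S_axiom[OF axioms.projection[of 1]] that]] S_Fm[OF that] h by simp
  have common: "A \<in> S" if "t :\<^bsub>Common\<^esub> A \<in> S" for t
    using everyone[OF S_mp[OF S_axiom[OF axioms.co_closure_head] that]] S_Fm[OF that] by simp
  show ?thesis
    using assms agent everyone common by (cases s) auto
qed

subsection \<open>The canonical model\<close>

text \<open>\<open>undefined\<close> merely names an element of the arbitrary type
  \<open>'w\<close>. The sort is quantified existentially because \<open>evid\<close> receives a
  bare term.\<close>

definition canonical :: "('w, 'p) model" where
  "canonical = \<lparr>worlds = {undefined}, rel = (\<lambda>_. {(undefined, undefined)}),
     evid = (\<lambda>_ t. {A. \<exists>s. t :\<^bsub>s\<^esub> A \<in> S}), val = (\<lambda>p. {w. w = undefined \<and> Atom p \<in> S})\<rparr>"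

lemma canonical_simps [simp]:
  "worlds canonical = {undefined}"
  "rel canonical i = {(undefined, undefined)}"
  "w \<in> val canonical p \<longleftrightarrow> w = undefined \<and> Atom p \<in> S"
  by (simp_all add: canonical_def)

lemma evid_canonical:
  assumes "is_tm h s t"
  shows "A \<in> evid canonical w t \<longleftrightarrow> t :\<^bsub>s\<^esub> A \<in> S"
proof -
  have "s' = s" if "t :\<^bsub>s'\<^esub> A \<in> S" for s'
    using S_Fm[OF that] is_tm_sort_of[of h s' t] is_tm_sort_of[OF assms] by simp
  then show ?thesis by (auto simp: canonical_def)
qed

text \<open>Each closure condition on evidence is the matching axiom followed by modus ponens in
  \<open>S\<close>; the condition on constants comes from necessitation.\<close>

lemma canonical_af_model: "af_model h CS canonical"
proof
  fix w :: 'w and s t assume "s \<in> all_sorts h" "is_tm h s t"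
  then show "evid canonical w t \<subseteq> Fm h"
    using S_Fm by (fastforce simp: evid_canonical)
next
  fix w :: 'w and s n A assume "Const s n :\<^bsub>s\<^esub> A \<in> CS"
  then have "Const s n :\<^bsub>s\<^esub> A \<in> S"
    using closed derivable.nec unfolding deductively_closed_def by blast
  then show "A \<in> evid canonical w (Const s n)"
    by (auto simp: canonical_def)
next
  fix w :: 'w and s t u A B
  assume s: "s \<in> star_sorts h" and t: "is_tm h s t" and u: "is_tm h s u"
    and "A \<^bold>\<longrightarrow> B \<in> evid canonical w t" "A \<in> evid canonical w u"
  then have *: "t :\<^bsub>s\<^esub> (A \<^bold>\<longrightarrow> B) \<in> S" "u :\<^bsub>s\<^esub> A \<in> S"
    by (simp_all add: evid_canonical)
  show "B \<in> evid canonical w (App s t u)"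
    using S_mp[OF S_mp[OF S_axiom[OF axioms.app] *(1)] *(2)] s t u S_Fm[OF *(1)] is_tm.App[OF s t u]
    by (simp add: evid_canonical)
next
  fix w :: 'w and s t u
  assume s: "s \<in> star_sorts h" and t: "is_tm h s t" and u: "is_tm h s u"
  have "Plus s t u :\<^bsub>s\<^esub> A \<in> S" if "t :\<^bsub>s\<^esub> A \<in> S" for A
    using S_mp[OF S_axiom[OF axioms.sum_left] that] s t u S_Fm[OF that] by simp
  moreover have "Plus s t u :\<^bsub>s\<^esub> A \<in> S" if "u :\<^bsub>s\<^esub> A \<in> S" for A
    using S_mp[OF S_axiom[OF axioms.sum_right] that] s t u S_Fm[OF that] by simp
  ultimately show "evid canonical w t \<union> evid canonical w u \<subseteq> evid canonical w (Plus s t u)"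
    using t u is_tm.Plus[OF s t u] by (auto simp: evid_canonical)
next
  fix w :: 'w and i t A
  assume i: "i \<in> {1..h}" and t: "is_tm h (Agent i) t" and "A \<in> evid canonical w t"
  then have *: "t :\<^bsub>Agent i\<^esub> A \<in> S" by (simp add: evid_canonical)
  show "t :\<^bsub>Agent i\<^esub> A \<in> evid canonical w (Bang i t)"
    using S_mp[OF S_axiom[OF axioms.inspection[OF i t]] *] S_Fm[OF *] is_tm.Bang[OF i t]
    by (simp add: evid_canonical)
next
  fix w :: 'w and ts A
  assume len: "length ts = h" and ts: "\<And>i. i \<in> {1..h} \<Longrightarrow> is_tm h (Agent i) (ts ! (i - 1))"
    and A: "\<And>i. i \<in> {1..h} \<Longrightarrow> A \<in> evid canonical w (ts ! (i - 1))"
  have *: "(ts ! (i - 1)) :\<^bsub>Agent i\<^esub> A \<in> S" if i: "i \<in> {1..h}" for i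
    using A[OF i] by (simp only: evid_canonical[OF ts[OF i]])
  have "A \<in> Fm h" using S_Fm[OF *[of 1]] h by simp
  then have "conj_list (map (\<lambda>i. (ts ! (i - 1)) :\<^bsub>Agent i\<^esub> A) [1..<Suc h])
      \<^bold>\<longrightarrow> Tuple ts :\<^bsub>Everyone\<^esub> A \<in> S"
    by (intro S_axiom axioms.tupling len ts)
  moreover have "conj_list (map (\<lambda>i. (ts ! (i - 1)) :\<^bsub>Agent i\<^esub> A) [1..<Suc h]) \<in> S"
    using h * by (intro closed_conj_list[OF closed]) (auto simp del: upt_Suc)
  ultimately have "Tuple ts :\<^bsub>Everyone\<^esub> A \<in> S"
    by (rule S_mp)
  moreover have "is_tm h Everyone (Tuple ts)"
    using len ts by (rule is_tm.Tuple)
  ultimately show "A \<in> evid canonical w (Tuple ts)"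
    by (simp only: evid_canonical)
next
  fix w :: 'w and i t A
  assume i: "i \<in> {1..h}" and t: "is_tm h Everyone t" and "A \<in> evid canonical w t"
  then have *: "t :\<^bsub>Everyone\<^esub> A \<in> S" by (simp add: evid_canonical)
  show "A \<in> evid canonical w (Proj i t)"
    using S_mp[OF S_axiom[OF axioms.projection[OF i t]] *] S_Fm[OF *] is_tm.Proj[OF i t]
    by (simp add: evid_canonical)
next
  fix w :: 'w and t A
  assume t: "is_tm h Common t" and "A \<in> evid canonical w t"
  then have *: "t :\<^bsub>Common\<^esub> A \<in> S" by (simp add: evid_canonical)
  show "A \<in> evid canonical w (Hd t) \<and> t :\<^bsub>Common\<^esub> A \<in> evid canonical w (Tl t)"
    using S_mp[OF S_axiom[OF axioms.co_closure_head[OF t]] *]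
      S_mp[OF S_axiom[OF axioms.co_closure_tail[OF t]] *] S_Fm[OF *] is_tm.Hd[OF t] is_tm.Tl[OF t]
    by (simp add: evid_canonical)
next
  fix w :: 'w and t u A
  assume t: "is_tm h Common t" and u: "is_tm h Everyone u"
    and "A \<in> evid canonical w u" "A \<^bold>\<longrightarrow> u :\<^bsub>Everyone\<^esub> A \<in> evid canonical w t"
  then have *: "u :\<^bsub>Everyone\<^esub> A \<in> S" "t :\<^bsub>Common\<^esub> (A \<^bold>\<longrightarrow> u :\<^bsub>Everyone\<^esub> A) \<in> S"
    by (simp_all add: evid_canonical)
  \<comment> \<open>The axiom has \<open>A\<close> itself as a premise, whereas the model condition
    supplies only evidence for \<open>A\<close>; factivity bridges the gap.\<close>
  have "A \<^bold>\<and> t :\<^bsub>Common\<^esub> (A \<^bold>\<longrightarrow> u :\<^bsub>Everyone\<^esub> A) \<in> S"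
    using Ev_factive[OF *(1)] *(2) S_Fm[OF *(1)] S_Fm[OF *(2)] by (simp add: And_iff)
  from S_mp[OF S_axiom[OF axioms.induction[OF t u]] this]
  show "A \<in> evid canonical w (Ind t u)"
    using S_Fm[OF *(1)] is_tm.Ind[OF t u] by (simp add: evid_canonical)
\<comment> \<open>Monotonicity is among the remaining goals and holds because canonical evidence
  ignores the world.\<close>
qed (auto simp: refl_on_def trans_def canonical_def)

text \<open>In the evidence case the only accessible world is the world itself, so what is needed
  beyond evidence is truth of the body there, which follows from factivity and the induction
  hypothesis.\<close>

lemma truth_lemma:
  "A \<in> Fm h \<Longrightarrow> sat h (canonical :: ('w, 'p) model) undefined A \<longleftrightarrow> A \<in> S"
proof (induction rule: Fm.induct)
  case (Ev s t A)
  have "access h (canonical :: ('w, 'p) model) s = {(undefined, undefined)}"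
    by (rule access_one_world[OF canonical_af_model _ h]) (use Ev in simp_all)
  with Ev show ?case using Ev_factive by (auto simp: evid_canonical)
qed (simp_all add: Neg_iff And_iff Or_iff Imp_iff)

lemma canonical_m_model: "m_model h CS canonical"
  by (simp add: m_model_def canonical_af_model is_singleton_def)

lemma canonical_refutes: "\<not> valid h canonical F"
  using truth_lemma[OF F] F_notin by (simp add: valid_def)

end

text \<open>The type \<open>'w\<close> of worlds may be any type: all types are inhabited, so each
  one carries the canonical one-world model that refutes an underivable \<open>A\<close>.\<close>

theorem theorem2:
  fixes h :: nat and CS :: "'p::countable fm set" and A :: "'p fm"
  assumes "h \<ge> 1" and "const_spec h CS" and "A \<in> Fm h"
  shows "derivable h CS A \<longleftrightarrow>
    (\<forall>M :: ('w, 'p) model. m_model h CS M \<longrightarrow> valid h M A)"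
proof
  assume "derivable h CS A"
  with assms show "\<forall>M :: ('w, 'p) model. m_model h CS M \<longrightarrow> valid h M A"
    by (blast intro: soundness)
next
  assume valid: "\<forall>M :: ('w, 'p) model. m_model h CS M \<longrightarrow> valid h M A"
  show "derivable h CS A"
  proof (rule ccontr)
    assume "\<not> derivable h CS A"
    with assms obtain S where "maximal_closed h CS A S"
      using maximal_closed_exists by blast
    then show False
      using valid maximal_closed.canonical_m_model maximal_closed.canonical_refutes by blast
  qed
qed

end
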